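(* Let $M$ be a path connected metric space which is locally contractible. Let $f:M\to\mathbb{R}$ be a continuous proper function which is bounded from below. Then for each $a\in\mathbb{R}$ the number of bifurcation points $x\in M$ of $f$ with $f(x)\le a$ is not smaller than $\mathrm{cat}_M(M_{\le a})$, where $M_{\le a}=\{x\in M: f(x)\le a\}$.
   Context: Bifurcation points: a point $x\in M$ is a topologically regular point of $f$ if, with $a=f(x)$, there is a neighbourhood $U$ of $x$ and a homeomorphism $U\simeq S\times(a-\varepsilon,a+\varepsilon)$, for some topological space $S$ and $\varepsilon>0$, under which $f|_U$ coincides with the projection onto the second factor. A point that is not topologically regular is called a bifurcation point of $f$. ($M$ need not be a manifold.) Category: for a topological space $X$ and a closed subspace $Y\subset X$, the Lusternik--Schnirelmann category $\mathrm{cat}_X(Y)$ is the smallest cardinality of a covering of $Y$ by open sets which are contractible in $X$ (i.e. whose inclusion into $X$ is null-homotopic). *)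

theory Defs
  imports "HOL-Analysis.Analysis"
begin

unbundle cardinal_syntax

definition contractible_in :: "'a topology \<Rightarrow> 'a set \<Rightarrow> bool" where
  "contractible_in X U \<longleftrightarrow>
     (\<exists>c. homotopic_with (\<lambda>_. True) (subtopology X U) X id (\<lambda>_. c))"

(* The standard weak form of local contractibility: every neighbourhood of a point contains a
   smaller one that is null-homotopic in it.  The smaller neighbourhood need not be contractible
   in itself; spaces with a base of contractible neighbourhoods are covered by the lemma below. *)
definition locally_contractible_space :: "'a topology \<Rightarrow> bool" where
  "locally_contractible_space X \<longleftrightarrow>
     (\<forall>W x. openin X W \<and> x \<in> W \<longrightarrow>
        (\<exists>V. openin X V \<and> x \<in> V \<and> V \<subseteq> W \<and> contractible_in (subtopology X W) V))"

lemma neighbourhood_base_of_contractible_imp_locally_contractible_space: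
  assumes "neighbourhood_base_of (\<lambda>V. contractible_space (subtopology X V)) X"
  shows "locally_contractible_space X"
  unfolding locally_contractible_space_def
proof (intro allI impI)
  fix W x
  assume "openin X W \<and> x \<in> W"
  then obtain U V where UV: "openin X U" "contractible_space (subtopology X V)"
      "x \<in> U" "U \<subseteq> V" "V \<subseteq> W"
    using assms unfolding neighbourhood_base_of by metis
  then obtain c where c: "homotopic_with (\<lambda>_. True) (subtopology X V) (subtopology X V) id (\<lambda>_. c)"
    by (auto simp: contractible_space_def)
  have 1: "continuous_map (subtopology X U) (subtopology X V) id"
    using UV by (auto simp: continuous_map_in_subtopology continuous_map_from_subtopology)
  have 2: "continuous_map (subtopology X V) (subtopology X W) id"
    using UV by (auto simp: continuous_map_in_subtopology continuous_map_from_subtopology)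
  have "homotopic_with (\<lambda>_. True) (subtopology X V) (subtopology X W) (id \<circ> id) (id \<circ> (\<lambda>_. c))"
    by (rule homotopic_with_compose_continuous_map_left [OF c 2]) simp
  then have "homotopic_with (\<lambda>_. True) (subtopology X U) (subtopology X W)
      ((id \<circ> id) \<circ> id) ((id \<circ> (\<lambda>_. c)) \<circ> id)"
    by (rule homotopic_with_compose_continuous_map_right [OF _ 1]) simp
  then have "homotopic_with (\<lambda>_. True) (subtopology (subtopology X W) U) (subtopology X W) id (\<lambda>_. c)"
    using UV by (simp add: o_def id_def subtopology_subtopology Int_absorb1)
  then show "\<exists>V. openin X V \<and> x \<in> V \<and> V \<subseteq> W \<and> contractible_in (subtopology X W) V"
    using UV unfolding contractible_in_def by blast
qed

(* The neighbourhood U need not be open.  The factor S may be taken to live on the type of the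
   points of X, because S is homeomorphic to the fibre of f over f x in U; the lemma
   topologically_regularI below shows that no generality is lost. *)
definition topologically_regular :: "'a topology \<Rightarrow> ('a \<Rightarrow> real) \<Rightarrow> 'a \<Rightarrow> bool" where
  "topologically_regular X f x \<longleftrightarrow>
     (\<exists>W U. openin X W \<and> x \<in> W \<and> W \<subseteq> U \<and> U \<subseteq> topspace X \<and>
        (\<exists>(S :: 'a topology) \<epsilon> \<phi>. \<epsilon> > 0 \<and>
           homeomorphic_map (subtopology X U)
             (prod_topology S (top_of_set {f x - \<epsilon><..<f x + \<epsilon>})) \<phi> \<and>
           (\<forall>u\<in>U. f u = snd (\<phi> u))))"

lemma topologically_regularI:
  fixes X :: "'a topology" and S :: "'b topology"
  assumes W: "openin X W" "x \<in> W" "W \<subseteq> U" "U \<subseteq> topspace X" and "\<epsilon> > 0"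
    and hom: "homeomorphic_map (subtopology X U)
          (prod_topology S (top_of_set {f x - \<epsilon><..<f x + \<epsilon>})) \<phi>"
    and f: "\<forall>u\<in>U. f u = snd (\<phi> u)"
  shows "topologically_regular X f x"
proof -
  let ?I = "top_of_set {f x - \<epsilon><..<f x + \<epsilon>}"
  have fx: "f x \<in> topspace ?I"
    using \<open>\<epsilon> > 0\<close> by simp
  obtain g where g: "homeomorphic_maps (subtopology X U) (prod_topology S ?I) \<phi> g"
    using hom homeomorphic_map_maps by blast
  define e where "e = (\<lambda>s. g (s, f x))"
  define T where "T = subtopology (subtopology X U) (e ` topspace S)"
  have g': "embedding_map (prod_topology S ?I) (subtopology X U) g"
    using g unfolding embedding_map_def homeomorphic_maps_map
    by (metis homeomorphic_imp_surjective_map subtopology_topspace)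
  have "embedding_map S (prod_topology S ?I) (\<lambda>s. (s, f x))"
    using fx by (simp add: embedding_map_graph)
  then have "embedding_map S (subtopology X U) e"
    using embedding_map_compose [OF _ g'] by (simp add: e_def o_def)
  then obtain h where h: "homeomorphic_maps S T e h"
    unfolding embedding_map_def T_def homeomorphic_map_maps by blast
  then have "homeomorphic_map (prod_topology S ?I) (prod_topology T ?I) (\<lambda>(s,r). (e s, id r))"
    unfolding homeomorphic_map_maps using h homeomorphic_maps_prod homeomorphic_maps_id by blast
  then have hom': "homeomorphic_map (subtopology X U) (prod_topology T ?I) ((\<lambda>(s,r). (e s, id r)) \<circ> \<phi>)"
    by (rule homeomorphic_map_compose [OF hom])
  have "\<forall>u\<in>U. f u = snd (((\<lambda>(s,r). (e s, id r)) \<circ> \<phi>) u)"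
    using f by (simp add: case_prod_unfold)
  then show ?thesis
    unfolding topologically_regular_def using W \<open>\<epsilon> > 0\<close> hom' by blast
qed

definition bifurcation_points :: "'a topology \<Rightarrow> ('a \<Rightarrow> real) \<Rightarrow> 'a set" where
  "bifurcation_points X f = {x \<in> topspace X. \<not> topologically_regular X f x}"

definition categorical_cover :: "'a topology \<Rightarrow> 'a set \<Rightarrow> 'a set set \<Rightarrow> bool" where
  "categorical_cover X Y \<U> \<longleftrightarrow>
     (\<forall>U\<in>\<U>. openin X U \<and> contractible_in X U) \<and> Y \<subseteq> \<Union>\<U>"

(* A cardinal in the sense of HOL's cardinal library, so that infinite values are distinguished.
   It is unspecified if Y has no covering of the required kind. *)
definition LS_cat :: "'a topology \<Rightarrow> 'a set \<Rightarrow> 'a set rel" where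
  "LS_cat X Y =
     (SOME \<kappa>. \<exists>\<U>. categorical_cover X Y \<U> \<and> \<kappa> = |\<U>| \<and>
        (\<forall>\<V>. categorical_cover X Y \<V> \<longrightarrow> |\<U>| \<le>o |\<V>| ))"

lemma LS_cat_attained:
  assumes "categorical_cover X Y \<W>"
  shows "\<exists>\<U>. categorical_cover X Y \<U> \<and> LS_cat X Y = |\<U>| \<and>
           (\<forall>\<V>. categorical_cover X Y \<V> \<longrightarrow> |\<U>| \<le>o |\<V>| )"
proof -
  let ?R = "{|\<U>| | \<U>. categorical_cover X Y \<U>}"
  have "?R \<noteq> {}"
    using assms by blast
  moreover have "\<forall>r\<in>?R. Card_order r"
    using card_of_Card_order by blast
  ultimately obtain r where r: "r \<in> ?R" "\<forall>r'\<in>?R. r \<le>o r'"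
    using exists_minim_Card_order [of ?R] by blast
  then have "\<exists>\<kappa> \<U>. categorical_cover X Y \<U> \<and> \<kappa> = |\<U>| \<and>
      (\<forall>\<V>. categorical_cover X Y \<V> \<longrightarrow> |\<U>| \<le>o |\<V>| )"
    by blast
  then show ?thesis
    unfolding LS_cat_def by (rule someI_ex)
qed

end

theory Submission
  imports Defs
begin

text \<open>Pushing down in a product chart, damped by a bump function, gives a self-map of the whole
  space, homotopic to the identity, that lowers \<open>f\<close> wherever it moves a point.  Such maps compose,
  so finitely many of them lower \<open>f\<close> strictly on any compact set of regular points, without any
  vector field or global flow.  If \<open>c\<close> is the infimum of the levels whose sublevel set cannot be
  covered by as many categorical sets as it has bifurcation points, one removes a categorical
  neighbourhood of each bifurcation point at level \<open>c\<close>, pushes the rest of the sublevel set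
  strictly below \<open>c\<close>, and pulls back a covering from there; properness extends the covering
  to slightly higher levels, a contradiction.  If there are infinitely many bifurcation points,
  compactness of the sublevel set suffices.\<close>

section \<open>Self-maps homotopic to the identity that lower \<open>f\<close>\<close>

text \<open>Only the end map \<open>g\<close> is compared with \<open>f\<close>; the homotopy may be
  arbitrary, since it serves solely to transfer null-homotopies along \<open>g\<close>.\<close>

definition descending_deformation :: "'a topology \<Rightarrow> ('a \<Rightarrow> real) \<Rightarrow> ('a \<Rightarrow> 'a) \<Rightarrow> bool" where
  "descending_deformation X f g \<longleftrightarrow>
     homotopic_with (\<lambda>_. True) X X id g \<and> (\<forall>u\<in>topspace X. g u = u \<or> f (g u) < f u)"

lemma descending_deformation_id: "descending_deformation X f id"
  by (simp add: descending_deformation_def)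

lemma descending_deformation_continuous_map:
  "descending_deformation X f g \<Longrightarrow> continuous_map X X g"
  by (auto simp: descending_deformation_def dest: homotopic_with_imp_continuous_maps)

text \<open>If \<open>g\<close> moves \<open>u\<close>, then \<open>f\<close> has already dropped
  and \<open>h\<close> cannot raise it again; if \<open>g\<close> fixes \<open>u\<close>, then
  \<open>h\<close> acts at \<open>u\<close> itself. Hence both alternatives in the second claim can
  be tested at the original point \<open>u\<close>, wherever \<open>g\<close> sends it.\<close>

lemma descending_deformation_compose:
  assumes g: "descending_deformation X f g" and h: "descending_deformation X f h"
  shows "descending_deformation X f (h \<circ> g)"
    and "\<lbrakk>u \<in> topspace X; f (g u) < f u \<or> f (h u) < f u\<rbrakk> \<Longrightarrow> f ((h \<circ> g) u) < f u"
proof -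
  have cg: "continuous_map X X g"
    using g by (rule descending_deformation_continuous_map)
  have "homotopic_with (\<lambda>_. True) X X (id \<circ> g) (h \<circ> g)"
    by (rule homotopic_with_compose_continuous_map_right [OF _ cg])
      (use h in \<open>auto simp: descending_deformation_def\<close>)
  then have "homotopic_with (\<lambda>_. True) X X id (h \<circ> g)"
    using g homotopic_with_trans unfolding descending_deformation_def by fastforce
  moreover have "g u \<in> topspace X" if "u \<in> topspace X" for u
    using cg that by (metis continuous_map_image_subset_topspace image_subset_iff)
  ultimately show "descending_deformation X f (h \<circ> g)"
    and "\<lbrakk>u \<in> topspace X; f (g u) < f u \<or> f (h u) < f u\<rbrakk> \<Longrightarrow> f ((h \<circ> g) u) < f u"
    using g h unfolding descending_deformation_def comp_apply
    by (metis order_less_trans)+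
qed

text \<open>In a product chart the deformation slides a point down along the interval factor, by an
  amount that is positive at \<open>x\<close> and vanishes near the boundary of the chart.\<close>

lemma descending_deformation_at_regular_point:
  assumes X: "completely_regular_space X" and f: "continuous_map X euclideanreal f"
    and reg: "topologically_regular X f x"
  obtains V g where "openin X V" "x \<in> V" "descending_deformation X f g"
    "\<And>u. u \<in> V \<Longrightarrow> f (g u) < f u"
proof -
  obtain W U and S :: "'a topology" and \<epsilon> \<phi> where W: "openin X W" "x \<in> W" "W \<subseteq> U" "U \<subseteq> topspace X"
    and \<epsilon>: "\<epsilon> > 0"
    and hom: "homeomorphic_map (subtopology X U)
          (prod_topology S (top_of_set {f x - \<epsilon><..<f x + \<epsilon>})) \<phi>"
    and f\<phi>: "\<And>u. u \<in> U \<Longrightarrow> f u = snd (\<phi> u)"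
    using reg unfolding topologically_regular_def by blast
  define J where "J = {f x - \<epsilon><..<f x + \<epsilon>}"
  obtain \<psi> where \<psi>: "homeomorphic_maps (subtopology X U) (prod_topology S (top_of_set J)) \<phi> \<psi>"
    using hom homeomorphic_map_maps unfolding J_def by blast
  then have c\<phi>: "continuous_map (subtopology X U) (prod_topology S (top_of_set J)) \<phi>"
    and c\<psi>: "continuous_map (prod_topology S (top_of_set J)) (subtopology X U) \<psi>"
    and \<psi>\<phi>: "\<And>u. u \<in> U \<Longrightarrow> \<psi> (\<phi> u) = u"
    and \<phi>\<psi>: "\<And>p. p \<in> topspace S \<times> J \<Longrightarrow> \<phi> (\<psi> p) = p"
    using W by (auto simp: homeomorphic_maps_def)
  have \<phi>S: "fst (\<phi> u) \<in> topspace S" if "u \<in> U" for u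
    using continuous_map_image_subset_topspace [OF c\<phi>] that W
    by (auto simp: image_subset_iff mem_Times_iff)
  have \<psi>U: "\<psi> p \<in> U" if "p \<in> topspace S \<times> J" for p
    using continuous_map_image_subset_topspace [OF c\<psi>] that by (auto simp: image_subset_iff)
  \<comment> \<open>Halving the width leaves room in \<open>J\<close> for a downward slide of length
    at most \<open>\<epsilon>/2\<close> starting at any point of \<open>V\<close>.\<close>
  define V where "V = {u \<in> W. f u \<in> {f x - \<epsilon>/2<..<f x + \<epsilon>/2}}"
  have VW: "V \<subseteq> W" and VU: "V \<subseteq> U" and xV: "x \<in> V"
    using W \<epsilon> by (auto simp: V_def)
  have "openin X {u \<in> topspace X. f u \<in> {f x - \<epsilon>/2<..<f x + \<epsilon>/2}}"
    by (rule openin_continuous_map_preimage [OF f]) simp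
  moreover have "V = W \<inter> {u \<in> topspace X. f u \<in> {f x - \<epsilon>/2<..<f x + \<epsilon>/2}}"
    using W by (auto simp: V_def)
  ultimately have oV: "openin X V"
    using W by auto
  then have "closedin X (topspace X - V)" "x \<in> topspace X - (topspace X - V)"
    using xV VW W by auto
  then obtain r :: "'a \<Rightarrow> real" where r: "continuous_map X (top_of_set {0..1}) r" "r x = 0"
      "r ` (topspace X - V) \<subseteq> {1}"
    using X unfolding completely_regular_space_def by blast
  then have cr: "continuous_map X euclideanreal r" and r0: "\<And>u. u \<in> topspace X \<Longrightarrow> 0 \<le> r u"
    by (auto simp: continuous_map_in_subtopology)
  \<comment> \<open>The cut-off at \<open>1/2\<close> makes \<open>\<tau>\<close> vanish on the
    whole open set where \<open>r\<close> exceeds \<open>1/2\<close>, which contains the complement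
    of \<open>V\<close>. The slide can then be glued to the identity over two open sets, as both
    agree where \<open>\<tau>\<close> is zero.\<close>
  define \<tau> where "\<tau> u = \<epsilon> * max 0 (1/2 - r u)" for u
  have c\<tau>: "continuous_map X euclideanreal \<tau>"
    unfolding \<tau>_def by (intro continuous_intros cr)
  have \<tau>: "0 \<le> \<tau> u" "\<tau> u \<le> \<epsilon>/2" if "u \<in> topspace X" for u
    using r0 [OF that] \<epsilon> by (auto simp: \<tau>_def max_def mult_le_0_iff field_simps)
  define slide where "slide = (\<lambda>(t,u). \<psi> (fst (\<phi> u), f u - t * \<tau> u))"
  define h where "h = (\<lambda>(t::real,u). if u \<in> V then slide (t,u) else u)"
  define V' where "V' = {u \<in> topspace X. r u \<in> {1/2<..}}"
  have oV': "openin X V'"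
    unfolding V'_def by (rule openin_continuous_map_preimage [OF cr]) simp
  have V'0: "\<tau> u = 0" if "u \<in> V'" for u
    using that by (auto simp: V'_def \<tau>_def)
  have cov: "u \<in> V'" if "u \<in> topspace X" "u \<notin> V" for u
    using that r by (force simp: V'_def image_subset_iff)
  have inJ: "(fst (\<phi> u), f u - t * \<tau> u) \<in> topspace S \<times> J" if "u \<in> V" "t \<in> {0..1}" for t u
  proof -
    have "u \<in> topspace X" using that oV openin_subset by blast
    then have "0 \<le> t * \<tau> u" "t * \<tau> u \<le> \<tau> u" "\<tau> u \<le> \<epsilon>/2"
      using \<tau> [of u] that by (auto intro: mult_left_le_one_le)
    then show ?thesis
      using that VU \<phi>S [of u] by (auto simp: J_def V_def)
  qed
  have slide0: "slide (t,u) = u" if "u \<in> V" "t * \<tau> u = 0" for t u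
  proof -
    have "(fst (\<phi> u), f u) = \<phi> u"
      using that VU f\<phi> by (metis prod.collapse subsetD)
    then show ?thesis
      using that VU \<psi>\<phi> by (auto simp: slide_def)
  qed
  have fslide: "f (slide (t,u)) = f u - t * \<tau> u" if "u \<in> V" "t \<in> {0..1}" for t u
    using inJ [OF that] \<psi>U f\<phi> \<phi>\<psi> by (simp add: slide_def)
  let ?I = "top_of_set {0..1::real}"
  have ch: "continuous_map (prod_topology ?I X) X h"
  proof (rule pasting_lemma [where I = "{True,False}" and T = "\<lambda>b. {0..1} \<times> (if b then V else V')"
        and f = "\<lambda>b. if b then slide else snd"])
    show "openin (prod_topology ?I X) ({0..1} \<times> (if b then V else V'))" for b
      using oV oV' by (simp add: openin_prod_Times_iff)
    have "continuous_map (subtopology (prod_topology ?I X) ({0..1} \<times> V)) X slide"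
    proof -
      have sub: "subtopology (prod_topology ?I X) ({0..1} \<times> V) = prod_topology ?I (subtopology X V)"
        by (simp add: prod_topology_subtopology subtopology_subtopology)
      let ?P = "prod_topology ?I (subtopology X V)"
      have sV: "continuous_map ?P (subtopology X V) snd"
        by (rule continuous_map_snd)
      have sX: "continuous_map ?P X snd"
        using sV by (simp add: continuous_map_in_subtopology)
      have s: "continuous_map ?P (subtopology X U) snd"
        using sV VU by (auto simp: continuous_map_in_subtopology)
      have 1: "continuous_map ?P S (\<lambda>p. fst (\<phi> (snd p)))"
        using continuous_map_compose [OF continuous_map_compose [OF s c\<phi>] continuous_map_fst]
        by (simp add: o_def)
      have ft: "continuous_map ?P euclideanreal fst"
        using continuous_map_fst [of ?I "subtopology X V"] by (simp add: continuous_map_in_subtopology)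
      have "continuous_map ?P euclideanreal (\<lambda>p. f (snd p) - fst p * \<tau> (snd p))"
        using continuous_map_compose [OF sX f] continuous_map_compose [OF sX c\<tau>] ft
        by (intro continuous_intros) (auto simp: o_def)
      moreover have "f (snd p) - fst p * \<tau> (snd p) \<in> J" if "p \<in> topspace ?P" for p
        using inJ [of "snd p" "fst p"] that by auto
      ultimately have 2: "continuous_map ?P (top_of_set J) (\<lambda>p. f (snd p) - fst p * \<tau> (snd p))"
        by (simp add: continuous_map_in_subtopology image_subset_iff)
      have "continuous_map ?P (prod_topology S (top_of_set J))
          (\<lambda>p. (fst (\<phi> (snd p)), f (snd p) - fst p * \<tau> (snd p)))"
        using 1 2 by (simp add: continuous_map_paired)
      from continuous_map_compose [OF this c\<psi>] have "continuous_map ?P (subtopology X U) slide"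
        by (simp add: o_def slide_def case_prod_unfold)
      then show ?thesis
        unfolding sub by (simp add: continuous_map_in_subtopology)
    qed
    then show "continuous_map (subtopology (prod_topology ?I X) ({0..1} \<times> (if b then V else V'))) X
        (if b then slide else snd)" for b
      by (auto intro: continuous_map_from_subtopology continuous_map_snd)
    show "(if b then slide else snd) p = (if b' then slide else snd) p"
      if "p \<in> topspace (prod_topology ?I X) \<inter> ({0..1} \<times> (if b then V else V'))
          \<inter> ({0..1} \<times> (if b' then V else V'))" for b b' p
      using that slide0 V'0 by (cases b; cases b'; cases p) auto
    show "\<exists>b. b \<in> {True,False} \<and> p \<in> {0..1} \<times> (if b then V else V')
        \<and> h p = (if b then slide else snd) p" if "p \<in> topspace (prod_topology ?I X)" for p
    proof (cases "snd p \<in> V")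
      case True
      then show ?thesis
        using that by (intro exI [of _ True]) (auto simp: h_def)
    next
      case False
      then show ?thesis
        using that cov by (intro exI [of _ False]) (auto simp: h_def)
    qed
  qed
  define g where "g u = h (1,u)" for u
  have "homotopic_with (\<lambda>_. True) X X id g"
    unfolding homotopic_with_def
    by (rule exI [of _ h]) (use ch slide0 in \<open>auto simp: g_def h_def\<close>)
  moreover have "g u = u \<or> f (g u) < f u" if "u \<in> topspace X" for u
    using \<tau>(1) [OF that] fslide [of u 1] slide0 [of u 1] by (auto simp: g_def h_def)
  ultimately have dd: "descending_deformation X f g"
    by (simp add: descending_deformation_def)
  \<comment> \<open>Since \<open>r\<close> is 1 off \<open>V\<close>, the set \<open>N\<close> lies
    in \<open>V\<close>, and \<open>\<tau>\<close> is positive on all of it, so the slide at time 1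
    strictly lowers \<open>f\<close> there.\<close>
  define N where "N = {u \<in> topspace X. r u \<in> {..<1/2}}"
  show thesis
  proof
    show "openin X N"
      unfolding N_def by (rule openin_continuous_map_preimage [OF cr]) simp
    show "x \<in> N"
      using r W VW xV openin_subset by (auto simp: N_def)
    show "descending_deformation X f g" by (fact dd)
    fix u
    assume u: "u \<in> N"
    then have "u \<in> V"
      using r by (force simp: N_def image_subset_iff)
    moreover have "\<tau> u > 0"
      using u \<epsilon> by (auto simp: N_def \<tau>_def)
    ultimately show "f (g u) < f u"
      using fslide [of u 1] by (simp add: g_def h_def)
  qed
qed

text \<open>The local pushes of a finite subcover are composed. A point may leave its neighbourhood
  before its own push is applied, but then an earlier push has already lowered it.\<close>

lemma descending_deformation_on_compact:
  assumes X: "completely_regular_space X" and f: "continuous_map X euclideanreal f"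
    and K: "compactin X K" and reg: "\<And>x. x \<in> K \<Longrightarrow> topologically_regular X f x"
  obtains g where "descending_deformation X f g" "\<And>u. u \<in> K \<Longrightarrow> f (g u) < f u"
proof -
  have "\<forall>x\<in>K. \<exists>V g. openin X V \<and> x \<in> V \<and> descending_deformation X f g \<and> (\<forall>u\<in>V. f (g u) < f u)"
    by (metis descending_deformation_at_regular_point [OF X f] reg)
  then obtain V g where V: "\<And>x. x \<in> K \<Longrightarrow> openin X (V x)" "\<And>x. x \<in> K \<Longrightarrow> x \<in> V x"
    and g: "\<And>x. x \<in> K \<Longrightarrow> descending_deformation X f (g x)"
      "\<And>x u. \<lbrakk>x \<in> K; u \<in> V x\<rbrakk> \<Longrightarrow> f (g x u) < f u"
    by metis
  have "\<exists>\<F>. finite \<F> \<and> \<F> \<subseteq> V ` K \<and> K \<subseteq> \<Union>\<F>"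
    by (rule compactinD [OF K]) (use V in auto)
  then obtain F where F: "finite F" "F \<subseteq> K" "K \<subseteq> \<Union>(V ` F)"
    using finite_subset_image by metis
  from F(1,2) have "\<exists>g. descending_deformation X f g \<and> (\<forall>u\<in>\<Union>(V ` F). f (g u) < f u)"
  proof (induction F rule: finite_induct)
    case empty
    then show ?case
      using descending_deformation_id by auto
  next
    case (insert x F)
    then obtain g' where g': "descending_deformation X f g'" "\<And>u. u \<in> \<Union>(V ` F) \<Longrightarrow> f (g' u) < f u"
      by auto
    have sub: "\<Union>(V ` insert x F) \<subseteq> topspace X"
      using V insert.prems openin_subset by blast
    show ?case
    proof (intro exI conjI ballI)
      show "descending_deformation X f (g' \<circ> g x)"
        using g g' insert.prems by (simp add: descending_deformation_compose)
      fix u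
      assume u: "u \<in> \<Union>(V ` insert x F)"
      then have "f (g x u) < f u \<or> f (g' u) < f u"
        using g'(2) g(2) insert.prems by auto
      then show "f ((g' \<circ> g x) u) < f u"
        using u sub g g' insert.prems by (intro descending_deformation_compose(2) [of X]) auto
    qed
  qed
  then show thesis
    using that F(3) by blast
qed

section \<open>Categorical sets and coverings under deformation\<close>

text \<open>The inclusion of the preimage is homotopic to the restriction of \<open>g\<close>, which
  factors through \<open>U\<close>, where the inclusion is null-homotopic.\<close>

lemma contractible_in_preimage:
  assumes hom: "homotopic_with (\<lambda>_. True) X X id g" and U: "contractible_in X U"
  shows "contractible_in X {x \<in> topspace X. g x \<in> U}"
proof -
  let ?P = "{x \<in> topspace X. g x \<in> U}"
  obtain c where c: "homotopic_with (\<lambda>_. True) (subtopology X U) X id (\<lambda>_. c)"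
    using U unfolding contractible_in_def by blast
  have cg: "continuous_map X X g"
    using hom homotopic_with_imp_continuous_maps by blast
  have "homotopic_with (\<lambda>_. True) (subtopology X ?P) X (id \<circ> id) (g \<circ> id)"
    by (rule homotopic_with_compose_continuous_map_right [OF hom])
      (auto simp: continuous_map_from_subtopology)
  moreover have "continuous_map (subtopology X ?P) (subtopology X U) g"
    using cg by (auto simp: continuous_map_in_subtopology continuous_map_from_subtopology)
  then have "homotopic_with (\<lambda>_. True) (subtopology X ?P) X (id \<circ> g) ((\<lambda>_. c) \<circ> g)"
    by (rule homotopic_with_compose_continuous_map_right [OF c]) simp
  ultimately have "homotopic_with (\<lambda>_. True) (subtopology X ?P) X id (\<lambda>_. c)"
    using homotopic_with_trans by (fastforce simp: o_def id_def)
  then show ?thesis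
    unfolding contractible_in_def by blast
qed

text \<open>This transports a covering from a lower sublevel set to any set that \<open>g\<close>
  pushes into it, without increasing the number of members.\<close>

lemma categorical_cover_preimage:
  assumes hom: "homotopic_with (\<lambda>_. True) X X id g" and \<U>: "categorical_cover X Z \<U>"
    and Y: "Y \<subseteq> topspace X" "g ` Y \<subseteq> Z"
  shows "categorical_cover X Y ((\<lambda>U. {x \<in> topspace X. g x \<in> U}) ` \<U>)"
proof -
  have "continuous_map X X g"
    using hom homotopic_with_imp_continuous_maps by blast
  then show ?thesis
    using \<U> Y contractible_in_preimage [OF hom] openin_continuous_map_preimage [of X X g]
    unfolding categorical_cover_def by (fastforce simp: image_subset_iff)
qed

lemma locally_contractible_space_imp_contractible_in_neighbourhood:
  assumes "locally_contractible_space X" "x \<in> topspace X"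
  shows "\<exists>V. openin X V \<and> x \<in> V \<and> contractible_in X V"
proof -
  obtain V where "openin X V" "x \<in> V" "contractible_in (subtopology X (topspace X)) V"
    using assms unfolding locally_contractible_space_def by (metis openin_topspace)
  then show ?thesis
    by auto
qed

section \<open>Sublevel sets of a proper function\<close>

text \<open>A lower bound \<open>m\<close> turns the sublevel set into the preimage of the compact
  interval from \<open>m\<close> to \<open>c\<close>.\<close>

lemma compactin_sublevel:
  assumes "proper_map X euclideanreal f" "bdd_below (f ` topspace X)"
  shows "compactin X {x \<in> topspace X. f x \<le> c}"
proof -
  obtain m where "\<And>x. x \<in> topspace X \<Longrightarrow> m \<le> f x"
    using assms(2) unfolding bdd_below_def by blast
  then have "{x \<in> topspace X. f x \<le> c} = {x \<in> topspace X. f x \<in> {m..c}}"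
    by auto
  then show ?thesis
    using compactin_proper_map_preimage [OF assms(1), of "{m..c}"] by simp
qed

text \<open>The image of the complement of \<open>W\<close> is closed and misses \<open>c\<close>,
  hence misses a ball around \<open>c\<close>. Points outside \<open>W\<close> have values above
  \<open>c\<close>, so their values lie beyond that ball.\<close>

lemma closed_map_sublevel_neighbourhood:
  fixes c :: real
  assumes "closed_map X euclideanreal f" "openin X W" "{x \<in> topspace X. f x \<le> c} \<subseteq> W"
  obtains d where "d > c" "{x \<in> topspace X. f x \<le> d} \<subseteq> W"
proof -
  have "closed (f ` (topspace X - W))"
    using assms(1,2) unfolding closed_map_def closed_closedin by blast
  moreover have "c \<notin> f ` (topspace X - W)"
    using assms(3) by auto
  ultimately obtain e where e: "e > 0" "ball c e \<subseteq> - f ` (topspace X - W)"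
    by (metis ComplI open_Compl open_contains_ball)
  show thesis
  proof
    show "c + e/2 > c" using e by simp
    show "{x \<in> topspace X. f x \<le> c + e/2} \<subseteq> W"
    proof clarify
      fix x
      assume x: "x \<in> topspace X" "f x \<le> c + e/2"
      show "x \<in> W"
      proof (rule ccontr)
        assume "x \<notin> W"
        then have "f x > c" "f x \<notin> ball c e"
          using x assms(3) e by auto
        then show False
          using x e by (simp add: dist_real_def)
      qed
    qed
  qed
qed

section \<open>Finitely many bifurcation points: induction over real levels\<close>

lemma finite_bifurcation_points_imp_categorical_cover:
  assumes X: "completely_regular_space X" "locally_contractible_space X"
    and f: "continuous_map X euclideanreal f" "proper_map X euclideanreal f"
      "bdd_below (f ` topspace X)"
    and fin: "finite {x \<in> bifurcation_points X f. f x \<le> a}"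
  shows "\<exists>\<U>. finite \<U> \<and> categorical_cover X {x \<in> topspace X. f x \<le> a} \<U> \<and>
           card \<U> \<le> card {x \<in> bifurcation_points X f. f x \<le> a}"
proof -
  define L where "L c = {x \<in> topspace X. f x \<le> c}" for c
  define B where "B c = {x \<in> bifurcation_points X f. f x \<le> c}" for c
  define Q where "Q c \<longleftrightarrow> (\<exists>\<U>. finite \<U> \<and> categorical_cover X (L c) \<U> \<and> card \<U> \<le> card (B c))" for c
  \<comment> \<open>\<open>card\<close> is 0 on infinite sets, so the bound in \<open>Q\<close> is
    the intended one only at levels where \<open>B c\<close> is finite.\<close>
  have finB: "finite (B c)" if "c \<le> a" for c
    using that by (intro finite_subset [OF _ fin]) (auto simp: B_def)
  obtain m where m: "\<And>x. x \<in> topspace X \<Longrightarrow> m \<le> f x"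
    using f(3) unfolding bdd_below_def by blast
  have below: "Q c" if "c < m" for c
  proof -
    have "L c = {}" using m that by (force simp: L_def)
    then show ?thesis
      unfolding Q_def by (intro exI [of _ "{}"]) (simp add: categorical_cover_def)
  qed
  have mono: "Q d" if \<U>: "finite \<U>" "categorical_cover X (L d) \<U>" "card \<U> \<le> card (B c)"
    and "c \<le> d" "d \<le> a" for \<U> c d
  proof -
    have "card (B c) \<le> card (B d)"
      using that finB by (intro card_mono) (auto simp: B_def)
    then show ?thesis
      using \<U> unfolding Q_def by (meson order_trans)
  qed
  \<comment> \<open>Passage to the limit from below: the bifurcation points at level
    \<open>c\<close> pay for the sets added to a covering pulled back from a lower level.\<close>
  have step: "\<exists>\<U>. finite \<U> \<and> categorical_cover X (L c) \<U> \<and> card \<U> \<le> card (B c)"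
    if c: "c \<le> a" and less: "\<And>d. d < c \<Longrightarrow> Q d" for c
  proof -
    define P where "P = {x \<in> bifurcation_points X f. f x = c}"
    have finP: "finite P"
      using finB [OF c] by (rule rev_finite_subset) (auto simp: P_def B_def)
    have "P \<subseteq> topspace X"
      by (auto simp: P_def bifurcation_points_def)
    then have "\<forall>p\<in>P. \<exists>V. openin X V \<and> p \<in> V \<and> contractible_in X V"
      using locally_contractible_space_imp_contractible_in_neighbourhood [OF X(2)] by blast
    then obtain N where N: "\<And>p. p \<in> P \<Longrightarrow> openin X (N p) \<and> p \<in> N p \<and> contractible_in X (N p)"
      by metis
    \<comment> \<open>\<open>K\<close> is the part of \<open>A\<close> at level \<open>c\<close>.
      All bifurcation points of that level lie in the removed sets, so \<open>K\<close> consists of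
      regular points. The points of \<open>A\<close> below level \<open>c\<close> need not be
      regular: it suffices that \<open>g\<close> does not raise them.\<close>
    define K where "K = {x \<in> topspace X. f x = c} - \<Union>(N ` P)"
    define A where "A = L c - \<Union>(N ` P)"
    have oN: "openin X (\<Union>(N ` P))"
      using N by blast
    have diff: "compactin X (T - \<Union>(N ` P))" if "compactin X T" for T
    proof -
      have "T - \<Union>(N ` P) = (topspace X - \<Union>(N ` P)) \<inter> T"
        using compactin_subset_topspace [OF that] by blast
      then show ?thesis
        using closed_Int_compactin [of X "topspace X - \<Union>(N ` P)" T] oN that by auto
    qed
    have cA: "compactin X A"
      unfolding A_def L_def using compactin_sublevel f diff by blast
    have "compactin X {x \<in> topspace X. f x \<in> {c}}"
      by (rule compactin_proper_map_preimage [OF f(2)]) simp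
    then have cK: "compactin X K"
      unfolding K_def using diff by simp
    have "topologically_regular X f x" if "x \<in> K" for x
      using that N by (force simp: K_def P_def bifurcation_points_def)
    then obtain g where g: "descending_deformation X f g" "\<And>u. u \<in> K \<Longrightarrow> f (g u) < f u"
      using descending_deformation_on_compact [OF X(1) f(1) cK] by blast
    have gA: "f (g u) < c" if "u \<in> A" for u
      using that g unfolding descending_deformation_def
      by (cases "f u = c") (force simp: A_def K_def L_def)+
    \<comment> \<open>Compactness of \<open>A\<close> makes the strict inequality uniform:
      \<open>d\<close> is the maximum of \<open>f \<circ> g\<close> on \<open>A\<close>, or
      \<open>c - 1\<close> if \<open>A\<close> is empty.\<close>
    obtain d where d: "d < c" "\<And>u. u \<in> A \<Longrightarrow> f (g u) \<le> d"
    proof (cases "A = {}")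
      case True
      then show thesis using that [of "c - 1"] by simp
    next
      case False
      have "continuous_map X euclideanreal (f \<circ> g)"
        using continuous_map_compose descending_deformation_continuous_map f(1) g(1) by blast
      then have "compact ((f \<circ> g) ` A)"
        using image_compactin [OF cA] by fastforce
      then obtain u where "u \<in> A" "\<And>v. v \<in> A \<Longrightarrow> f (g v) \<le> f (g u)"
        using compact_attains_sup [of "(f \<circ> g) ` A"] False by auto
      then show thesis
        using that gA by blast
    qed
    obtain \<U> where \<U>: "finite \<U>" "categorical_cover X (L d) \<U>" "card \<U> \<le> card (B d)"
      using less [OF d(1)] unfolding Q_def by blast
    let ?\<V> = "(\<lambda>U. {x \<in> topspace X. g x \<in> U}) ` \<U>"
    have Asub: "A \<subseteq> topspace X"
      by (auto simp: A_def L_def)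
    have "g ` A \<subseteq> L d"
      using d Asub descending_deformation_continuous_map [OF g(1)]
      by (auto simp: L_def continuous_map_def)
    then have \<V>: "categorical_cover X A ?\<V>"
      using categorical_cover_preimage [OF _ \<U>(2) Asub] g(1)
      unfolding descending_deformation_def by blast
    have "categorical_cover X (L c) (?\<V> \<union> N ` P)"
      using \<V> N unfolding categorical_cover_def A_def by auto
    moreover have "card (?\<V> \<union> N ` P) \<le> card (B c)"
    proof -
      have "card (?\<V> \<union> N ` P) \<le> card (B d) + card P"
        using card_Un_le [of ?\<V> "N ` P"] card_image_le [OF \<U>(1), of "\<lambda>U. {x \<in> topspace X. g x \<in> U}"]
          card_image_le [OF finP, of N] \<U>(3) by linarith
      \<comment> \<open>Points of \<open>B d\<close> have level at most \<open>d < c\<close> and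
        points of \<open>P\<close> have level \<open>c\<close>, so nothing is counted twice.\<close>
      also have "\<dots> = card (B d \<union> P)"
        using finB [of d] finP c d by (intro card_Un_disjoint [symmetric]) (auto simp: B_def P_def)
      also have "\<dots> \<le> card (B c)"
        using finB [OF c] d by (intro card_mono) (auto simp: B_def P_def)
      finally show ?thesis .
    qed
    ultimately show ?thesis
      using \<U>(1) finP by (intro exI [of _ "?\<V> \<union> N ` P"]) simp
  qed
  have "Q a"
  proof (rule ccontr)
    assume "\<not> Q a"
    \<comment> \<open>Levels above \<open>a\<close> are left out because finiteness of
      \<open>B\<close> is known only up to \<open>a\<close>. The set is bounded below because
      \<open>Q\<close> holds below the lower bound \<open>m\<close> of \<open>f\<close>.\<close>
    define Bad where "Bad = {c. c \<le> a \<and> \<not> Q c}"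
    have ne: "Bad \<noteq> {}" and bdd: "bdd_below Bad"
      using \<open>\<not> Q a\<close> below by (auto simp: Bad_def bdd_below_def not_less [symmetric])
    define c where "c = Inf Bad"
    have ca: "c \<le> a"
      using \<open>\<not> Q a\<close> bdd by (auto simp: c_def Bad_def intro: cInf_lower)
    have "Q d" if "d < c" for d
      using that ca bdd cInf_lower [of d Bad] by (force simp: c_def Bad_def)
    then obtain \<U> where \<U>: "finite \<U>" "categorical_cover X (L c) \<U>" "card \<U> \<le> card (B c)"
      using step [OF ca] by blast
    \<comment> \<open>The covering of \<open>L c\<close> is open, so it also covers
      \<open>L e\<close> for some \<open>e > c\<close>. Every bad level below \<open>e\<close> is at
      least \<open>c\<close> and is therefore served by this same covering.\<close>
    obtain e where e: "c < e" "L e \<subseteq> \<Union>\<U>"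
      using closed_map_sublevel_neighbourhood [of X f "\<Union>\<U>" c] \<U>(2) f(2)
      unfolding categorical_cover_def L_def by (metis openin_Union proper_imp_closed_map)
    obtain d where d: "d \<in> Bad" "d < e"
      using cInf_lessD [OF ne] e(1) c_def by blast
    have "c \<le> d"
      using d bdd by (simp add: c_def cInf_lower)
    have "L d \<subseteq> L e"
      using d by (auto simp: L_def)
    then have "categorical_cover X (L d) \<U>"
      using \<U>(2) e unfolding categorical_cover_def by blast
    then have "Q d"
      using mono [OF \<U>(1) _ \<U>(3) \<open>c \<le> d\<close>] d by (simp add: Bad_def)
    then show False
      using d by (simp add: Bad_def)
  qed
  then show ?thesis
    by (simp add: Q_def L_def B_def)
qed

section \<open>Finite coverings of compact sets and the bound on the category\<close>

lemma compactin_imp_finite_categorical_cover: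
  assumes X: "locally_contractible_space X" and K: "compactin X K"
  shows "\<exists>\<U>. finite \<U> \<and> categorical_cover X K \<U>"
proof -
  let ?\<U> = "{U. openin X U \<and> contractible_in X U}"
  have "K \<subseteq> \<Union>?\<U>"
    using locally_contractible_space_imp_contractible_in_neighbourhood [OF X]
      compactin_subset_topspace [OF K] by blast
  then obtain \<U> where "finite \<U>" "\<U> \<subseteq> ?\<U>" "K \<subseteq> \<Union>\<U>"
    using K unfolding compactin_def by (metis (no_types, lifting) mem_Collect_eq)
  then show ?thesis
    unfolding categorical_cover_def by blast
qed

text \<open>The given covering also shows that the choice in \<open>LS_cat\<close> is made from a
  nonempty set, so that minimality applies.\<close>

lemma LS_cat_le:
  assumes "categorical_cover X Y \<U>"
  shows "LS_cat X Y \<le>o |\<U>|"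
  using LS_cat_attained [OF assms] assms by metis

theorem theorem22:
  fixes M :: "'a metric" and f :: "'a \<Rightarrow> real" and a :: real
  assumes "path_connected_space (mtopology_of M)"
    and "locally_contractible_space (mtopology_of M)"
    and "continuous_map (mtopology_of M) euclideanreal f"
    and "proper_map (mtopology_of M) euclideanreal f"
    and "bdd_below (f ` mspace M)"
  shows "LS_cat (mtopology_of M) {x \<in> mspace M. f x \<le> a}
           \<le>o |{x \<in> bifurcation_points (mtopology_of M) f. f x \<le> a}|"
proof -
  let ?X = "mtopology_of M"
  let ?L = "{x \<in> mspace M. f x \<le> a}"
  let ?B = "{x \<in> bifurcation_points ?X f. f x \<le> a}"
  \<comment> \<open>Complete regularity of the metric topology supplies the bump functions for the
    local pushes.\<close>
  have cr: "completely_regular_space ?X"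
    unfolding mtopology_of_def
    by (rule Metric_space.completely_regular_space_mtopology [OF Metric_space_mspace_mdist])
  have "\<exists>\<U>. categorical_cover ?X ?L \<U> \<and> |\<U>| \<le>o |?B|"
  proof (cases "finite ?B")
    case True
    then obtain \<U> where "finite \<U>" "categorical_cover ?X ?L \<U>" "card \<U> \<le> card ?B"
      using finite_bifurcation_points_imp_categorical_cover [OF cr assms(2-4)] assms(5) by auto
    then show ?thesis
      using True card_le_inj [of \<U> ?B] card_of_ordLeq [of \<U> ?B] by blast
  next
    case False
    \<comment> \<open>Any finite covering suffices here, since every finite cardinal lies below the
      infinite one of \<open>?B\<close>.\<close>
    have "compactin ?X ?L"
      using compactin_sublevel [OF assms(4)] assms(5) by simp
    then obtain \<U> where "finite \<U>" "categorical_cover ?X ?L \<U>"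
      using compactin_imp_finite_categorical_cover [OF assms(2)] by blast
    then show ?thesis
      using False ordLeq3_finite_infinite by blast
  qed
  then show ?thesis
    using LS_cat_le ordLeq_transitive by blast
qed

end
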